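(* Consider the stochastic approximation recursion $w_{k+1}=w_k+\gamma_{k+1}H(w_k,X_{k+1})$, $k\ge 0$, with filtration $(\mathcal F_k)$ described in the context. Assume the following, with $V=W:\mathbb R^d\to\mathbb R_+$. (A) $\mathbb E[\|H(w_k,X_{k+1})\|^2]<\infty$ for all $k\ge0$, and there are constants $c_{h,0},c_{h,1},\tau_0,\tau_1,\sigma_0^2,\sigma_1^2\in\mathbb R_+$ such that $\|h(w)\|^2\le c_{h,0}+c_{h,1}W(w)$ for all $w\in\mathbb R^d$ and, for every $k\ge 0$, almost surely, $$\|\mathbb E[H(w_k,X_{k+1})\mid\mathcal F_k]-h(w_k)\|^2\le\tau_0+\tau_1W(w_k),$$ $$\mathbb E\big[\|H(w_k,X_{k+1})-\mathbb E[H(w_k,X_{k+1})\mid\mathcal F_k]\|^2\mid\mathcal F_k\big]\le\sigma_0^2+\sigma_1^2W(w_k).$$ (B) $V=W$ is continuously differentiable with $L_V$-Lipschitz gradient, and there is $\rho>0$ with $\langle\nabla V(w),h(w)\rangle\le-\rho W(w)$ for all $w\in\mathbb R^d$. (C) $c_V(\sqrt{\tau_0}/2+\sqrt{\tau_1})<\rho$. (D) The step size sequence $(\gamma_k)_{k\in\mathbb N}$ is positive and non-increasing, and for every $k\in\mathbb N$, $\gamma_k\le\gamma_{\max}/2$ and $$\frac{\gamma_k}{\gamma_{k+1}}\le1+\gamma_{k+1}\frac{\rho-b_1}{4}.$$ Then for any $k\ge0$, $$\mathbb E[W(w_k)]\le\Lambda_{1:k}\,\mathbb E[W(w_0)]+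\frac{2L_V\eta_0}{\rho-b_1}\gamma_k+\frac{2b_0}{\rho-b_1}.$$
   Context: $h:\mathbb R^d\to\mathbb R^d$ (mean field), $H:\mathbb R^d\times\mathsf X\to\mathbb R^d$ (stochastic oracle) are Borel functions; $(X_k)_{k\ge1}$ are $\mathsf X$-valued random variables; $w_0$ is an $\mathbb R^d$-valued random variable. $\mathcal F_k:=\sigma(w_0,X_1,\dots,X_k)$. $c_V\in(0,+\infty]$ is a constant such that $\|\nabla V(w)\|\le c_V\sqrt{W(w)}$ for all $w\in\mathbb R^d$; $c_V=+\infty$ is allowed and means that no such bound is required. Conventions: $0\cdot\infty=0$, $0^{-1}=\infty$. Constants: $b_0:=c_V\sqrt{\tau_0}/2$, $\ b_1:=c_V(\sqrt{\tau_0}/2+\sqrt{\tau_1})$; for $\ell\in\{0,1\}$, $\eta_\ell:=\sigma_\ell^2+\tau_\ell+c_{h,\ell}+\sqrt{c_{h,\ell}}(\sqrt{\tau_0}+\sqrt{\tau_1})+\sqrt{\tau_\ell}(\sqrt{c_{h,0}}+\sqrt{c_{h,1}})$; $\gamma_{\max}:=2(\rho-b_1)/(L_V\eta_1)$ (equal to $+\infty$ if $\eta_1=0$); $\lambda_k:=1-\gamma_k(\rho-b_1)+\gamma_k^2L_V\eta_1/2$ and $\Lambda_{1:k}:=\prod_{i=1}^k\lambda_i$ with $\Lambda_{1:0}:=1$. *)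

theory Defs
  imports "HOL-Probability.Probability"
begin

text \<open>
  The natural filtration \<open>\<sigma>(w\<^sub>0, X\<^sub>1, \<dots>, X\<^sub>k)\<close>. The library represents a sub-sigma-algebra as a
  measure; only its space and its sets matter.
\<close>

definition sa_filtration ::
  "'a measure \<Rightarrow> 's measure \<Rightarrow> ('a \<Rightarrow> 'v::topological_space) \<Rightarrow> (nat \<Rightarrow> 'a \<Rightarrow> 's) \<Rightarrow> nat \<Rightarrow> 'a measure"
  where
  "sa_filtration M S w0 X k =
     sigma (space M)
       ({w0 -` A \<inter> space M | A. A \<in> sets borel} \<union>
        (\<Union>i\<in>{1..k}. {X i -` B \<inter> space M | B. B \<in> sets S}))"

text \<open>
  The library only has conditional expectations of real-valued functions; for an integrable
  vector-valued function they are taken componentwise.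
\<close>

definition vec_cond_exp ::
  "'a measure \<Rightarrow> 'a measure \<Rightarrow> ('a \<Rightarrow> real ^ 'd) \<Rightarrow> 'a \<Rightarrow> real ^ 'd"
  where "vec_cond_exp M F f \<omega> = (\<chi> i. real_cond_exp M F (\<lambda>x. f x $ i) \<omega>)"

text \<open>
  The constant \<open>cV\<close> may be infinite, so the constants depending on it are extended reals. The type
  \<^typ>\<open>ereal\<close> satisfies \<open>0 * \<infinity> = 0\<close> and \<open>inverse 0 = \<infinity>\<close>. In particular \<open>sa_gamma_max\<close> is \<open>\<infinity>\<close>
  if \<open>LV * eta1 = 0\<close> and \<open>b1 < \<rho>\<close>.
\<close>

definition sa_b0 :: "ereal \<Rightarrow> (nat \<Rightarrow> real) \<Rightarrow> ereal" where
  "sa_b0 cV \<tau> = cV * ereal (sqrt (\<tau> 0)) / 2"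

definition sa_b1 :: "ereal \<Rightarrow> (nat \<Rightarrow> real) \<Rightarrow> ereal" where
  "sa_b1 cV \<tau> = cV * ereal (sqrt (\<tau> 0) / 2 + sqrt (\<tau> 1))"

definition sa_eta :: "(nat \<Rightarrow> real) \<Rightarrow> (nat \<Rightarrow> real) \<Rightarrow> (nat \<Rightarrow> real) \<Rightarrow> nat \<Rightarrow> real" where
  "sa_eta ch \<tau> \<sigma> l =
     (\<sigma> l)\<^sup>2 + \<tau> l + ch l
     + sqrt (ch l) * (sqrt (\<tau> 0) + sqrt (\<tau> 1))
     + sqrt (\<tau> l) * (sqrt (ch 0) + sqrt (ch 1))"

definition sa_gamma_max :: "real \<Rightarrow> ereal \<Rightarrow> real \<Rightarrow> real \<Rightarrow> ereal" where
  "sa_gamma_max \<rho> b1 LV eta1 = 2 * (ereal \<rho> - b1) / ereal (LV * eta1)"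

definition sa_lambda :: "real \<Rightarrow> ereal \<Rightarrow> real \<Rightarrow> real \<Rightarrow> (nat \<Rightarrow> real) \<Rightarrow> nat \<Rightarrow> ereal" where
  "sa_lambda \<rho> b1 LV eta1 \<gamma> k =
     1 - ereal (\<gamma> k) * (ereal \<rho> - b1) + ereal ((\<gamma> k)\<^sup>2 * LV * eta1 / 2)"

definition sa_Lambda :: "real \<Rightarrow> ereal \<Rightarrow> real \<Rightarrow> real \<Rightarrow> (nat \<Rightarrow> real) \<Rightarrow> nat \<Rightarrow> ereal" where
  "sa_Lambda \<rho> b1 LV eta1 \<gamma> k = (\<Prod>i=1..k. sa_lambda \<rho> b1 LV eta1 \<gamma> i)"

text \<open>The expectation, in \<open>[0, \<infinity>]\<close>, of a nonnegative random variable.\<close>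

definition nonneg_expectation :: "'a measure \<Rightarrow> ('a \<Rightarrow> real) \<Rightarrow> ereal" where
  "nonneg_expectation M f = enn2ereal (\<integral>\<^sup>+\<omega>. ennreal (f \<omega>) \<partial>M)"

end

theory Submission
  imports Defs
begin

text \<open>
  The theorem is a one-step contraction of \<open>\<E>[W(w\<^sub>n)]\<close>, iterated.

  By the descent inequality (\<open>quadratic_upper_bound\<close>), the next value of \<open>W\<close> is at most its first
  order expansion plus \<open>\<gamma>\<^sup>2 L \<parallel>H\<parallel>\<^sup>2 / 2\<close>. Conditionally on the past, the first order term is the
  drift \<open>\<langle>\<nabla>W, h\<rangle> \<le> -\<rho> W\<close> plus the alignment of \<open>\<nabla>W\<close> with the bias, at most \<open>b\<^sub>0 + b\<^sub>1 W\<close>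
  (\<open>bias_constants_real\<close>), and the second moment of \<open>H\<close> is at most \<open>\<eta>\<^sub>0 + \<eta>\<^sub>1 W\<close>
  (\<open>second_moment_le\<close>). With \<open>\<beta> = \<rho> - b\<^sub>1\<close> this gives
  \<open>\<E>[W(w\<^sub>n\<^sub>+\<^sub>1)] \<le> \<lambda>\<^sub>n\<^sub>+\<^sub>1 \<E>[W(w\<^sub>n)] + \<gamma>\<^sub>n\<^sub>+\<^sub>1 b\<^sub>0 + \<gamma>\<^sub>n\<^sub>+\<^sub>1\<^sup>2 L \<eta>\<^sub>0 / 2\<close> (\<open>expected_descent_step\<close>), and the
  step-size conditions are what make \<open>(2 L \<eta>\<^sub>0 \<gamma>\<^sub>k + 2 b\<^sub>0) / \<beta>\<close> a supersolution of this recursion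
  (\<open>stochastic_approximation_recursion\<close>).

  Two points need care.

  The expectation of \<open>W(w\<^sub>0)\<close> may be infinite, so \<open>\<nabla>W(w\<^sub>n)\<close> need not be square integrable and the
  conditional expectations cannot be manipulated globally. The one-step inequality is therefore
  first shown on the past events \<open>{W(w\<^sub>n) \<le> N}\<close>, where \<open>\<nabla>W(w\<^sub>n)\<close> and the conditional mean of \<open>H\<close>
  are bounded, and then extended by monotone convergence.

  Iterating also requires \<open>\<lambda>\<^sub>n \<ge> 0\<close>, and the step-size conditions alone do not force this. It
  follows from the geometry of \<open>W\<close>: unless \<open>W\<close> vanishes identically, \<open>\<rho>\<^sup>2 \<le> 2 L c\<^sub>h\<^sub>,\<^sub>1\<close>
  (\<open>drift_rate_le\<close>). Since \<open>c\<^sub>h\<^sub>,\<^sub>1 \<le> \<eta>\<^sub>1\<close> and \<open>\<beta> \<le> \<rho>\<close>, the quadratic \<open>1 - \<gamma> \<beta> + \<gamma>\<^sup>2 L \<eta>\<^sub>1 / 2\<close> is then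
  bounded below by \<open>(1 - \<gamma> \<beta> / 2)\<^sup>2\<close>. The same inequality shows \<open>L \<eta>\<^sub>1 > 0\<close>, so that \<open>\<gamma>\<^sub>m\<^sub>a\<^sub>x\<close> is finite.
\<close>

section \<open>Functions with Lipschitz gradient\<close>

lemma borel_measurable_gderiv:
  fixes f :: "'a::real_inner \<Rightarrow> real"
  assumes "\<And>u. GDERIV f u :> g u"
  shows "f \<in> borel_measurable borel"
  using assms unfolding gderiv_def
  by (intro borel_measurable_continuous_onI continuous_at_imp_continuous_on ballI
      has_derivative_continuous) auto

text \<open>
  Along the segment from \<open>u\<close> to \<open>u + v\<close> the directional derivative grows at rate at most
  \<open>L \<parallel>v\<parallel>\<^sup>2\<close>, so subtracting the claimed quadratic leaves a nonincreasing function.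
\<close>

lemma quadratic_upper_bound:
  fixes f :: "'a::real_inner \<Rightarrow> real"
  assumes grad: "\<And>u. GDERIV f u :> g u"
    and lip: "L-lipschitz_on UNIV g"
  shows "f (u + v) \<le> f u + g u \<bullet> v + L / 2 * (norm v)\<^sup>2"
proof -
  define \<phi> where "\<phi> t = f (u + t *\<^sub>R v) - t * (g u \<bullet> v) - L / 2 * t\<^sup>2 * (norm v)\<^sup>2" for t
  have deriv: "(\<phi> has_real_derivative (g (u + t *\<^sub>R v) - g u) \<bullet> v - L * t * (norm v)\<^sup>2) (at t)" for t
  proof -
    have line: "((\<lambda>t. u + t *\<^sub>R v) has_derivative (\<lambda>s. s *\<^sub>R v)) (at t)"
      by (auto intro!: derivative_eq_intros)
    have "(f has_derivative (\<lambda>x. x \<bullet> g (u + t *\<^sub>R v))) (at (u + t *\<^sub>R v))"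
      using grad by (simp add: gderiv_def)
    from has_derivative_compose[OF line this]
    have "((\<lambda>t. f (u + t *\<^sub>R v)) has_real_derivative g (u + t *\<^sub>R v) \<bullet> v) (at t)"
      by (simp add: has_field_derivative_def inner_commute mult.commute mult_commute_abs)
    then show ?thesis
      unfolding \<phi>_def
      by (auto intro!: derivative_eq_intros simp: inner_diff_left)
  qed
  have "\<phi> 1 \<le> \<phi> 0"
  proof (rule DERIV_nonpos_imp_nonincreasing[of 0 1 \<phi>])
    fix t :: real assume t: "0 \<le> t" "t \<le> 1"
    have "(g (u + t *\<^sub>R v) - g u) \<bullet> v \<le> norm (g (u + t *\<^sub>R v) - g u) * norm v"
      by (rule norm_cauchy_schwarz)
    also have "norm (g (u + t *\<^sub>R v) - g u) * norm v \<le> L * (t * norm v) * norm v"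
    proof (rule mult_right_mono)
      show "norm (g (u + t *\<^sub>R v) - g u) \<le> L * (t * norm v)"
        using lipschitz_onD[OF lip, of "u + t *\<^sub>R v" u] t by (simp add: dist_norm)
    qed simp
    finally have "(g (u + t *\<^sub>R v) - g u) \<bullet> v \<le> L * (t * norm v) * norm v" .
    then have "(g (u + t *\<^sub>R v) - g u) \<bullet> v - L * t * (norm v)\<^sup>2 \<le> 0"
      by (simp add: power2_eq_square mult.assoc)
    with deriv show "\<exists>y. (\<phi> has_real_derivative y) (at t) \<and> y \<le> 0" by blast
  qed simp
  then show ?thesis by (simp add: \<phi>_def)
qed

lemma quadratic_lower_bound:
  fixes f :: "'a::real_inner \<Rightarrow> real"
  assumes grad: "\<And>u. GDERIV f u :> g u"
    and lip: "L-lipschitz_on UNIV g"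
  shows "f u + g u \<bullet> v - L / 2 * (norm v)\<^sup>2 \<le> f (u + v)"
proof -
  have "- f (u + v) \<le> - f u + (- g u) \<bullet> v + L / 2 * (norm v)\<^sup>2"
    by (rule quadratic_upper_bound[where f = "\<lambda>u. - f u" and g = "\<lambda>u. - g u"])
      (use grad lip in \<open>auto intro: GDERIV_minus\<close>)
  then show ?thesis by simp
qed

text \<open>
  A gradient step of size \<open>1 / L\<close> lowers \<open>f\<close> by at least \<open>\<parallel>\<nabla>f\<parallel>\<^sup>2 / (2 L)\<close>, and \<open>f\<close> cannot become
  negative.
\<close>

lemma gradient_sq_le:
  fixes f :: "'a::real_inner \<Rightarrow> real"
  assumes grad: "\<And>u. GDERIV f u :> g u"
    and lip: "L-lipschitz_on UNIV g" and L: "0 < L" and nonneg: "\<And>u. 0 \<le> f u"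
  shows "(norm (g u))\<^sup>2 \<le> 2 * L * f u"
proof -
  have "0 \<le> f (u + (- (1 / L)) *\<^sub>R g u)" by (rule nonneg)
  also have "\<dots> \<le> f u + g u \<bullet> ((- (1 / L)) *\<^sub>R g u) + L / 2 * (norm ((- (1 / L)) *\<^sub>R g u))\<^sup>2"
    by (rule quadratic_upper_bound[OF grad lip])
  also have "\<dots> = f u - (norm (g u))\<^sup>2 / (2 * L)"
    using L by (simp add: power_mult_distrib power2_norm_eq_inner[symmetric] power2_eq_square divide_simps)
  finally show ?thesis using L by (simp add: field_simps)
qed

lemma gradient_ascent_gain:
  fixes f :: "'a::real_inner \<Rightarrow> real"
  assumes grad: "\<And>u. GDERIV f u :> g u"
    and lip: "L-lipschitz_on UNIV g" and L: "0 < L"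
  shows "f u + (norm (g u))\<^sup>2 / (2 * L) \<le> f (u + (1 / L) *\<^sub>R g u)"
proof -
  have "f u + (norm (g u))\<^sup>2 / (2 * L)
      = f u + g u \<bullet> ((1 / L) *\<^sub>R g u) - L / 2 * (norm ((1 / L) *\<^sub>R g u))\<^sup>2"
    using L by (simp add: power_mult_distrib power2_norm_eq_inner[symmetric] power2_eq_square divide_simps)
  also have "\<dots> \<le> f (u + (1 / L) *\<^sub>R g u)"
    by (rule quadratic_lower_bound[OF grad lip])
  finally show ?thesis .
qed

text \<open>
  Suppose \<open>\<rho>\<^sup>2 > 2 L c\<^sub>1\<close>. The drift condition and Cauchy-Schwarz bound \<open>\<parallel>\<nabla>W\<parallel>\<close> from below:
  \<open>(\<rho> W)\<^sup>2 \<le> \<parallel>\<nabla>W\<parallel>\<^sup>2 (c\<^sub>0 + c\<^sub>1 W)\<close>. Together with \<open>\<parallel>\<nabla>W\<parallel>\<^sup>2 \<le> 2 L W\<close> this makes \<open>W\<close> bounded, hence also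
  \<open>\<parallel>\<nabla>W\<parallel>\<^sup>2\<close> at least a constant multiple of \<open>W\<^sup>2\<close>. A gradient ascent step starting where \<open>W\<close> is nearly
  maximal then exceeds the supremum.
\<close>

lemma drift_rate_le:
  fixes W :: "'a::real_inner \<Rightarrow> real"
  assumes grad: "\<And>u. GDERIV W u :> g u"
    and lip: "L-lipschitz_on UNIV g" and L: "0 < L"
    and nonneg: "\<And>u. 0 \<le> W u"
    and drift: "\<And>u. g u \<bullet> h u \<le> - \<rho> * W u" and \<rho>: "0 < \<rho>"
    and growth: "\<And>u. (norm (h u))\<^sup>2 \<le> c0 + c1 * W u" and c: "0 \<le> c0" "0 \<le> c1"
    and nonzero: "W u0 \<noteq> 0"
  shows "\<rho>\<^sup>2 \<le> 2 * L * c1"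
proof (rule ccontr)
  assume "\<not> ?thesis"
  then have gap: "0 < \<rho>\<^sup>2 - 2 * L * c1" by simp
  have grad_ge: "(\<rho> * W u)\<^sup>2 \<le> (norm (g u))\<^sup>2 * (c0 + c1 * W u)" for u
  proof -
    have "\<rho> * W u \<le> \<bar>g u \<bullet> h u\<bar>" using drift[of u] by simp
    also have "\<dots> \<le> norm (g u) * norm (h u)" by (rule Cauchy_Schwarz_ineq2)
    finally have "(\<rho> * W u)\<^sup>2 \<le> (norm (g u) * norm (h u))\<^sup>2"
      using \<rho> nonneg[of u] by (intro power_mono) auto
    also have "\<dots> \<le> (norm (g u))\<^sup>2 * (c0 + c1 * W u)"
      unfolding power_mult_distrib by (intro mult_left_mono growth) simp
    finally show ?thesis .
  qed
  define B where "B = 2 * L * c0 / (\<rho>\<^sup>2 - 2 * L * c1)"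
  have B: "W u \<le> B" for u
  proof (cases "W u = 0")
    case True
    then show ?thesis using c L gap by (simp add: B_def)
  next
    case False
    then have pos: "0 < W u" using nonneg[of u] by simp
    have "(\<rho> * W u)\<^sup>2 \<le> (2 * L * W u) * (c0 + c1 * W u)"
      using grad_ge[of u] gradient_sq_le[OF grad lip L nonneg, of u] c nonneg[of u]
      by (meson add_nonneg_nonneg mult_nonneg_nonneg mult_right_mono order_trans)
    then have "W u * (\<rho>\<^sup>2 * W u) \<le> W u * (2 * L * (c0 + c1 * W u))"
      by (simp add: power2_eq_square algebra_simps)
    then have "\<rho>\<^sup>2 * W u \<le> 2 * L * (c0 + c1 * W u)" using pos by simp
    then show ?thesis using gap by (simp add: B_def field_simps)
  qed
  \<comment> \<open>The summand 1 keeps the divisor \<open>K\<close> positive when \<open>c0 + c1 * B = 0\<close>.\<close>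
  define K where "K = c0 + c1 * B + 1"
  have Kle: "c0 + c1 * W u \<le> K" for u
    using B[of u] c by (simp add: K_def mult_left_mono add_increasing2)
  have K: "0 < K"
    using c B[of u0] nonneg[of u0] by (simp add: K_def add_nonneg_pos)
  define \<kappa> where "\<kappa> = \<rho>\<^sup>2 / (2 * L * K)"
  have \<kappa>: "0 < \<kappa>" using \<rho> L K by (simp add: \<kappa>_def)
  have gain: "W u + \<kappa> * (W u)\<^sup>2 \<le> W (u + (1 / L) *\<^sub>R g u)" for u
  proof -
    have "(\<rho> * W u)\<^sup>2 \<le> (norm (g u))\<^sup>2 * K"
      by (rule order_trans[OF grad_ge]) (intro mult_left_mono Kle, simp)
    then have "\<kappa> * (W u)\<^sup>2 \<le> (norm (g u))\<^sup>2 / (2 * L)"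
      using L K by (simp add: \<kappa>_def field_simps power_mult_distrib)
    with gradient_ascent_gain[OF grad lip L, of u] show ?thesis by simp
  qed
  define s where "s = Sup (range W)"
  have bdd: "bdd_above (range W)" using B by (auto intro!: bdd_aboveI)
  have le_s: "W u \<le> s" for u unfolding s_def using bdd by (auto intro: cSup_upper)
  have s: "0 < s" using le_s[of u0] nonneg[of u0] nonzero by simp
  \<comment> \<open>A value above \<open>s / 2\<close> ensures an ascent gain of at least \<open>\<kappa> (s / 2)\<^sup>2\<close>; a deficit below the
    supremum smaller than this is then overcome.\<close>
  have "max (s / 2) (s - \<kappa> * (s / 2)\<^sup>2) < Sup (range W)"
    using s \<kappa> by (simp add: s_def[symmetric])
  then obtain u where u: "s / 2 < W u" "s - \<kappa> * (s / 2)\<^sup>2 < W u"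
    using bdd by (subst (asm) less_cSup_iff) auto
  have "\<kappa> * (s / 2)\<^sup>2 \<le> \<kappa> * (W u)\<^sup>2"
    using u s \<kappa> by (intro mult_left_mono power_mono) auto
  then show False using gain[of u] le_s[of "u + (1 / L) *\<^sub>R g u"] u by simp
qed

section \<open>Conditional expectation of vector-valued functions\<close>

lemma borel_measurable_component:
  fixes f :: "'a \<Rightarrow> real ^ 'd"
  assumes "f \<in> borel_measurable N"
  shows "(\<lambda>\<omega>. f \<omega> $ i) \<in> borel_measurable N"
  using assms by (rule borel_measurable_continuous_on[rotated]) (intro continuous_intros)

lemma borel_measurable_vec_cond_exp [measurable]:
  "vec_cond_exp M F f \<in> borel_measurable F"
proof -
  have "(\<lambda>\<omega>. vec_cond_exp M F f \<omega> $ i) \<in> borel_measurable F" for i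
    by (simp add: vec_cond_exp_def)
  then show ?thesis
    by (auto simp: borel_measurable_euclidean_space[of "vec_cond_exp M F f"] Basis_vec_def inner_axis)
qed

text \<open>
  The product of the norms dominates every product of coordinates, so the scalar identity applies
  to each coordinate.
\<close>

lemma (in sigma_finite_subalgebra) integral_inner_vec_cond_exp:
  fixes Y G :: "'a \<Rightarrow> real ^ 'd"
  assumes int: "integrable M (\<lambda>\<omega>. norm (Y \<omega>) * norm (G \<omega>))"
    and Y: "Y \<in> borel_measurable F" and G [measurable]: "G \<in> borel_measurable M"
  shows "integrable M (\<lambda>\<omega>. Y \<omega> \<bullet> vec_cond_exp M F G \<omega>)"
    and "(\<integral>\<omega>. Y \<omega> \<bullet> vec_cond_exp M F G \<omega> \<partial>M) = (\<integral>\<omega>. Y \<omega> \<bullet> G \<omega> \<partial>M)"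
proof -
  have Y' [measurable]: "Y \<in> borel_measurable M" by (rule measurable_from_subalg[OF subalg Y])
  have Yi: "(\<lambda>\<omega>. Y \<omega> $ i) \<in> borel_measurable F" for i
    using Y by (intro borel_measurable_component)
  have inti: "integrable M (\<lambda>\<omega>. Y \<omega> $ i * G \<omega> $ i)" for i
  proof (rule Bochner_Integration.integrable_bound[OF int])
    show "(\<lambda>\<omega>. Y \<omega> $ i * G \<omega> $ i) \<in> borel_measurable M"
      by (intro borel_measurable_times borel_measurable_component Y' G)
  qed (auto simp: abs_mult intro!: mult_mono component_le_norm_cart)
  note intg = real_cond_exp_intg[OF inti Yi borel_measurable_component[OF G]]
  show "integrable M (\<lambda>\<omega>. Y \<omega> \<bullet> vec_cond_exp M F G \<omega>)"
    using intg(1) by (simp add: inner_vec_def vec_cond_exp_def)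
  show "(\<integral>\<omega>. Y \<omega> \<bullet> vec_cond_exp M F G \<omega> \<partial>M) = (\<integral>\<omega>. Y \<omega> \<bullet> G \<omega> \<partial>M)"
    using intg inti by (simp add: inner_vec_def vec_cond_exp_def)
qed

section \<open>The one-step inequality\<close>

text \<open>
  On an event \<open>A\<close> of the past on which \<open>W(x)\<close> is bounded, both \<open>\<nabla>W(x)\<close> and the conditional mean \<open>m\<close>
  of \<open>G\<close> are bounded: the former by \<open>\<parallel>\<nabla>W\<parallel>\<^sup>2 \<le> 2 L W\<close>, the latter by the assumption \<open>second\<close>, the
  conditional variance being nonnegative. Hence they may be paired with \<open>G\<close>, and orthogonality of
  \<open>m\<close> and \<open>G - m\<close> splits the second moment of \<open>G\<close> into conditional variance and \<open>\<parallel>m\<parallel>\<^sup>2\<close>. The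
  integrated descent inequality then contains only quantities that the assumptions control
  pointwise.
\<close>

lemma (in finite_measure_subalgebra) truncated_descent_step:
  fixes x G :: "'a \<Rightarrow> real ^ 'd" and W :: "real ^ 'd \<Rightarrow> real"
  assumes grad: "\<And>u. GDERIV W u :> g u"
    and lip: "L-lipschitz_on UNIV g" and L: "0 < L" and nonneg: "\<And>u. 0 \<le> W u"
    and x: "x \<in> borel_measurable F" and G [measurable]: "G \<in> borel_measurable M"
    and sq: "integrable M (\<lambda>\<omega>. (norm (G \<omega>))\<^sup>2)"
    and drift: "AE \<omega> in M. g (x \<omega>) \<bullet> vec_cond_exp M F G \<omega> \<le> b - \<beta> * W (x \<omega>)"
    and second: "AE \<omega> in M.
          real_cond_exp M F (\<lambda>\<omega>. (norm (G \<omega> - vec_cond_exp M F G \<omega>))\<^sup>2) \<omega>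
            + (norm (vec_cond_exp M F G \<omega>))\<^sup>2 \<le> \<eta>0 + \<eta>1 * W (x \<omega>)"
    and \<gamma>: "0 \<le> \<gamma>"
    and A: "A \<in> sets F" and bounded: "\<And>\<omega>. \<omega> \<in> A \<Longrightarrow> W (x \<omega>) \<le> N"
  defines "lam \<equiv> 1 - \<gamma> * \<beta> + \<gamma>\<^sup>2 * L * \<eta>1 / 2" and "d \<equiv> \<gamma> * b + \<gamma>\<^sup>2 * L * \<eta>0 / 2"
  shows "integrable M (\<lambda>\<omega>. indicator A \<omega> * W (x \<omega>))"
    and "integrable M (\<lambda>\<omega>. indicator A \<omega> * W (x \<omega> + \<gamma> *\<^sub>R G \<omega>))"
    and "(\<integral>\<omega>. indicator A \<omega> * W (x \<omega> + \<gamma> *\<^sub>R G \<omega>) \<partial>M)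
           \<le> lam * (\<integral>\<omega>. indicator A \<omega> * W (x \<omega>) \<partial>M) + d * measure M A"
proof -
  define m where "m = vec_cond_exp M F G"
  define v where "v = real_cond_exp M F (\<lambda>\<omega>. (norm (G \<omega> - m \<omega>))\<^sup>2)"
  define a :: "'a \<Rightarrow> real" where "a = indicator A"
  have W [measurable]: "W \<in> borel_measurable borel" by (rule borel_measurable_gderiv[OF grad])
  have g [measurable]: "g \<in> borel_measurable borel"
    using lipschitz_on_continuous_on[OF lip] by (rule borel_measurable_continuous_onI)
  have mF [measurable]: "m \<in> borel_measurable F" by (simp add: m_def borel_measurable_vec_cond_exp)
  have aF [measurable]: "a \<in> borel_measurable F" using A by (simp add: a_def)
  note from_F = measurable_from_subalg[OF subalg]
  note xM [measurable] = from_F[OF x] and mM [measurable] = from_F[OF mF]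
    and aM [measurable] = from_F[OF aF]
  have AM [measurable]: "A \<in> sets M" using A subalg by (auto simp: subalgebra_def)
  have vM [measurable]: "v \<in> borel_measurable M" by (simp add: v_def)
  have a01: "0 \<le> a \<omega>" "a \<omega> \<le> 1" "a \<omega> * a \<omega> = a \<omega>" for \<omega>
    by (auto simp: a_def indicator_def)

  have G_int: "integrable M (\<lambda>\<omega>. norm (G \<omega>))"
    by (rule square_integrable_imp_integrable) (use sq in auto)
  have W_le: "a \<omega> * W (x \<omega>) \<le> \<bar>N\<bar>" for \<omega>
    using bounded[of \<omega>] by (auto simp: a_def indicator_def)
  have aW: "integrable M (\<lambda>\<omega>. a \<omega> * W (x \<omega>))"
    by (rule integrable_const_bound[where B = "\<bar>N\<bar>"]) (use W_le a01 nonneg in auto)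
  have g_le: "a \<omega> * norm (g (x \<omega>)) \<le> sqrt (2 * L * \<bar>N\<bar>)" for \<omega>
  proof (cases "\<omega> \<in> A")
    case True
    have "(norm (g (x \<omega>)))\<^sup>2 \<le> 2 * L * W (x \<omega>)" by (rule gradient_sq_le[OF grad lip L nonneg])
    also have "\<dots> \<le> 2 * L * \<bar>N\<bar>"
      using bounded[OF True] L by (intro mult_left_mono) auto
    finally show ?thesis using True by (simp add: a_def real_le_rsqrt)
  qed (use L in \<open>simp add: a_def\<close>)

  have v_nonneg: "AE \<omega> in M. 0 \<le> v \<omega>"
    unfolding v_def by (rule real_cond_exp_pos) auto
  define C where "C = sqrt (\<bar>\<eta>0\<bar> + \<bar>\<eta>1\<bar> * \<bar>N\<bar>)"
  have m_le: "AE \<omega> in M. a \<omega> * norm (m \<omega>) \<le> C"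
    using v_nonneg second
  proof eventually_elim
    case (elim \<omega>)
    show ?case
    proof (cases "\<omega> \<in> A")
      case True
      have "(norm (m \<omega>))\<^sup>2 \<le> \<eta>0 + \<eta>1 * W (x \<omega>)"
        using elim by (simp add: m_def v_def)
      also have "\<dots> \<le> \<bar>\<eta>0\<bar> + \<bar>\<eta>1\<bar> * \<bar>N\<bar>"
        using bounded[OF True] nonneg[of "x \<omega>"]
        by (intro add_mono order_trans[OF abs_ge_self[of "\<eta>1 * W (x \<omega>)"]])
          (auto simp: abs_mult intro!: mult_left_mono)
      finally show ?thesis using True by (simp add: a_def C_def real_le_rsqrt)
    qed (simp add: a_def C_def)
  qed

  have gG: "integrable M (\<lambda>\<omega>. (a \<omega> *\<^sub>R g (x \<omega>)) \<bullet> m \<omega>)"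
    "(\<integral>\<omega>. (a \<omega> *\<^sub>R g (x \<omega>)) \<bullet> m \<omega> \<partial>M) = (\<integral>\<omega>. (a \<omega> *\<^sub>R g (x \<omega>)) \<bullet> G \<omega> \<partial>M)"
    and gG': "integrable M (\<lambda>\<omega>. (a \<omega> *\<^sub>R g (x \<omega>)) \<bullet> G \<omega>)"
  proof -
    have int: "integrable M (\<lambda>\<omega>. norm (a \<omega> *\<^sub>R g (x \<omega>)) * norm (G \<omega>))"
      by (rule Bochner_Integration.integrable_bound
          [OF integrable_mult_right[OF G_int, of "sqrt (2 * L * \<bar>N\<bar>)"]])
        (use g_le a01 L in \<open>auto intro!: mult_right_mono simp: abs_mult\<close>)
    have meas: "(\<lambda>\<omega>. a \<omega> *\<^sub>R g (x \<omega>)) \<in> borel_measurable F"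
      using x by measurable
    show "integrable M (\<lambda>\<omega>. (a \<omega> *\<^sub>R g (x \<omega>)) \<bullet> m \<omega>)"
      "(\<integral>\<omega>. (a \<omega> *\<^sub>R g (x \<omega>)) \<bullet> m \<omega> \<partial>M) = (\<integral>\<omega>. (a \<omega> *\<^sub>R g (x \<omega>)) \<bullet> G \<omega> \<partial>M)"
      unfolding m_def by (rule integral_inner_vec_cond_exp[OF int meas G])+
    show "integrable M (\<lambda>\<omega>. (a \<omega> *\<^sub>R g (x \<omega>)) \<bullet> G \<omega>)"
      by (rule Bochner_Integration.integrable_bound[OF int])
        (auto simp: abs_mult mult.assoc intro!: mult_left_mono Cauchy_Schwarz_ineq2)
  qed

  have mG: "integrable M (\<lambda>\<omega>. (a \<omega> *\<^sub>R m \<omega>) \<bullet> m \<omega>)"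
    "(\<integral>\<omega>. (a \<omega> *\<^sub>R m \<omega>) \<bullet> m \<omega> \<partial>M) = (\<integral>\<omega>. (a \<omega> *\<^sub>R m \<omega>) \<bullet> G \<omega> \<partial>M)"
    and mG': "integrable M (\<lambda>\<omega>. (a \<omega> *\<^sub>R m \<omega>) \<bullet> G \<omega>)"
  proof -
    have int: "integrable M (\<lambda>\<omega>. norm (a \<omega> *\<^sub>R m \<omega>) * norm (G \<omega>))"
      by (rule Bochner_Integration.integrable_bound[OF integrable_mult_right[OF G_int, of C]])
        (use m_le a01 in \<open>auto elim!: eventually_mono intro!: mult_right_mono simp: abs_mult C_def\<close>)
    have meas: "(\<lambda>\<omega>. a \<omega> *\<^sub>R m \<omega>) \<in> borel_measurable F"
      by measurable
    show "integrable M (\<lambda>\<omega>. (a \<omega> *\<^sub>R m \<omega>) \<bullet> m \<omega>)"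
      "(\<integral>\<omega>. (a \<omega> *\<^sub>R m \<omega>) \<bullet> m \<omega> \<partial>M) = (\<integral>\<omega>. (a \<omega> *\<^sub>R m \<omega>) \<bullet> G \<omega> \<partial>M)"
      using integral_inner_vec_cond_exp[OF int meas G] by (simp_all add: m_def)
    show "integrable M (\<lambda>\<omega>. (a \<omega> *\<^sub>R m \<omega>) \<bullet> G \<omega>)"
      by (rule Bochner_Integration.integrable_bound[OF int])
        (auto simp: abs_mult mult.assoc intro!: mult_left_mono Cauchy_Schwarz_ineq2)
  qed

  have aG: "integrable M (\<lambda>\<omega>. a \<omega> * (norm (G \<omega>))\<^sup>2)"
    by (rule Bochner_Integration.integrable_bound[OF sq]) (use a01 in \<open>auto intro!: mult_left_le_one_le\<close>)
  have expand: "a \<omega> * (norm (G \<omega> - m \<omega>))\<^sup>2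
      = a \<omega> * (norm (G \<omega>))\<^sup>2 - 2 * ((a \<omega> *\<^sub>R m \<omega>) \<bullet> G \<omega>) + (a \<omega> *\<^sub>R m \<omega>) \<bullet> m \<omega>" for \<omega>
    by (simp add: power2_norm_eq_inner inner_diff_left inner_diff_right inner_commute algebra_simps)
  have res_int: "integrable M (\<lambda>\<omega>. a \<omega> * (norm (G \<omega> - m \<omega>))\<^sup>2)"
    unfolding expand using aG mG mG'
    by (intro Bochner_Integration.integrable_add Bochner_Integration.integrable_diff
        integrable_mult_right)
  have av: "integrable M (\<lambda>\<omega>. a \<omega> * v \<omega>)"
    "(\<integral>\<omega>. a \<omega> * v \<omega> \<partial>M) = (\<integral>\<omega>. a \<omega> * (norm (G \<omega> - m \<omega>))\<^sup>2 \<partial>M)"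
    unfolding v_def by (rule real_cond_exp_intg[OF res_int aF], measurable)+
  have second_moment: "(\<integral>\<omega>. a \<omega> * (norm (G \<omega>))\<^sup>2 \<partial>M)
      = (\<integral>\<omega>. a \<omega> * v \<omega> \<partial>M) + (\<integral>\<omega>. (a \<omega> *\<^sub>R m \<omega>) \<bullet> m \<omega> \<partial>M)"
    unfolding av(2) expand using aG mG mG' by simp

  define R where "R \<omega> = a \<omega> * W (x \<omega>) + \<gamma> * ((a \<omega> *\<^sub>R g (x \<omega>)) \<bullet> G \<omega>)
      + \<gamma>\<^sup>2 * L / 2 * (a \<omega> * (norm (G \<omega>))\<^sup>2)" for \<omega>
  have R_int: "integrable M R"
    unfolding R_def using aW gG' aG by (intro Bochner_Integration.integrable_add integrable_mult_right)
  have le_R: "a \<omega> * W (x \<omega> + \<gamma> *\<^sub>R G \<omega>) \<le> R \<omega>" for \<omega>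
  proof -
    have "a \<omega> * W (x \<omega> + \<gamma> *\<^sub>R G \<omega>)
        \<le> a \<omega> * (W (x \<omega>) + g (x \<omega>) \<bullet> (\<gamma> *\<^sub>R G \<omega>) + L / 2 * (norm (\<gamma> *\<^sub>R G \<omega>))\<^sup>2)"
      by (intro mult_left_mono quadratic_upper_bound[OF grad lip] a01)
    also have "\<dots> = R \<omega>"
      by (simp add: R_def power_mult_distrib algebra_simps)
    finally show ?thesis .
  qed
  have next_int: "integrable M (\<lambda>\<omega>. a \<omega> * W (x \<omega> + \<gamma> *\<^sub>R G \<omega>))"
    by (rule Bochner_Integration.integrable_bound[OF R_int])
      (use le_R a01 nonneg in \<open>auto intro: order_trans[OF _ abs_ge_self]\<close>)

  have "(\<integral>\<omega>. a \<omega> * W (x \<omega> + \<gamma> *\<^sub>R G \<omega>) \<partial>M) \<le> (\<integral>\<omega>. R \<omega> \<partial>M)"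
    by (rule integral_mono[OF next_int R_int le_R])
  also have "\<dots> = (\<integral>\<omega>. a \<omega> * W (x \<omega>) \<partial>M) + \<gamma> * (\<integral>\<omega>. (a \<omega> *\<^sub>R g (x \<omega>)) \<bullet> m \<omega> \<partial>M)
      + \<gamma>\<^sup>2 * L / 2 * ((\<integral>\<omega>. a \<omega> * v \<omega> \<partial>M) + (\<integral>\<omega>. (a \<omega> *\<^sub>R m \<omega>) \<bullet> m \<omega> \<partial>M))"
    unfolding R_def gG(2) second_moment[symmetric] using aW gG' aG by simp
  also have "\<dots> = (\<integral>\<omega>. a \<omega> * W (x \<omega>) + \<gamma> * ((a \<omega> *\<^sub>R g (x \<omega>)) \<bullet> m \<omega>)
      + \<gamma>\<^sup>2 * L / 2 * (a \<omega> * v \<omega> + (a \<omega> *\<^sub>R m \<omega>) \<bullet> m \<omega>) \<partial>M)"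
    using aW gG(1) av(1) mG(1) by simp
  also have "\<dots> \<le> (\<integral>\<omega>. lam * (a \<omega> * W (x \<omega>)) + d * a \<omega> \<partial>M)"
  proof (rule integral_mono_AE)
    show "integrable M (\<lambda>\<omega>. a \<omega> * W (x \<omega>) + \<gamma> * ((a \<omega> *\<^sub>R g (x \<omega>)) \<bullet> m \<omega>)
        + \<gamma>\<^sup>2 * L / 2 * (a \<omega> * v \<omega> + (a \<omega> *\<^sub>R m \<omega>) \<bullet> m \<omega>))"
      using aW gG(1) av(1) mG(1)
      by (intro Bochner_Integration.integrable_add integrable_mult_right)
    show "integrable M (\<lambda>\<omega>. lam * (a \<omega> * W (x \<omega>)) + d * a \<omega>)"
      using aW by (intro Bochner_Integration.integrable_add integrable_mult_right)
        (auto simp: a_def less_top[symmetric])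
    show "AE \<omega> in M. a \<omega> * W (x \<omega>) + \<gamma> * ((a \<omega> *\<^sub>R g (x \<omega>)) \<bullet> m \<omega>)
        + \<gamma>\<^sup>2 * L / 2 * (a \<omega> * v \<omega> + (a \<omega> *\<^sub>R m \<omega>) \<bullet> m \<omega>) \<le> lam * (a \<omega> * W (x \<omega>)) + d * a \<omega>"
      using drift second
    proof eventually_elim
      case (elim \<omega>)
      have "a \<omega> * W (x \<omega>) + \<gamma> * ((a \<omega> *\<^sub>R g (x \<omega>)) \<bullet> m \<omega>)
          + \<gamma>\<^sup>2 * L / 2 * (a \<omega> * v \<omega> + (a \<omega> *\<^sub>R m \<omega>) \<bullet> m \<omega>)
        = a \<omega> * (W (x \<omega>) + \<gamma> * (g (x \<omega>) \<bullet> m \<omega>) + \<gamma>\<^sup>2 * L / 2 * (v \<omega> + (norm (m \<omega>))\<^sup>2))"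
        by (simp add: power2_norm_eq_inner algebra_simps)
      also have "\<dots> \<le> a \<omega> * (W (x \<omega>) + \<gamma> * (b - \<beta> * W (x \<omega>))
          + \<gamma>\<^sup>2 * L / 2 * (\<eta>0 + \<eta>1 * W (x \<omega>)))"
      proof (intro mult_left_mono[OF _ a01(1)] add_mono order_refl)
        show "\<gamma> * (g (x \<omega>) \<bullet> m \<omega>) \<le> \<gamma> * (b - \<beta> * W (x \<omega>))"
          using elim(1) \<gamma> unfolding m_def by (rule mult_left_mono)
        show "\<gamma>\<^sup>2 * L / 2 * (v \<omega> + (norm (m \<omega>))\<^sup>2) \<le> \<gamma>\<^sup>2 * L / 2 * (\<eta>0 + \<eta>1 * W (x \<omega>))"
          using elim(2) L unfolding m_def v_def by (intro mult_left_mono) auto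
      qed
      also have "\<dots> = lam * (a \<omega> * W (x \<omega>)) + d * a \<omega>"
        by (simp add: lam_def d_def algebra_simps)
      finally show ?case .
    qed
  qed
  also have "\<dots> = lam * (\<integral>\<omega>. a \<omega> * W (x \<omega>) \<partial>M) + d * measure M A"
    using aW by (simp add: a_def less_top[symmetric])
  finally show "(\<integral>\<omega>. indicator A \<omega> * W (x \<omega> + \<gamma> *\<^sub>R G \<omega>) \<partial>M)
      \<le> lam * (\<integral>\<omega>. indicator A \<omega> * W (x \<omega>) \<partial>M) + d * measure M A"
    by (simp add: a_def)
  show "integrable M (\<lambda>\<omega>. indicator A \<omega> * W (x \<omega>))"
    and "integrable M (\<lambda>\<omega>. indicator A \<omega> * W (x \<omega> + \<gamma> *\<^sub>R G \<omega>))"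
    using aW next_int by (simp_all add: a_def)
qed


text \<open>
  The truncations to \<open>{W(x) \<le> N}\<close> increase to the whole space. By monotone convergence the
  bound passes to the limit, whether or not \<open>W(x)\<close> has finite expectation.
  If the factor is \<open>0\<close>, then \<open>0 * \<infinity> = 0\<close> is the right convention: every truncated bound has first
  term \<open>0\<close>.
\<close>

lemma (in finite_measure_subalgebra) expected_descent_step:
  fixes x G :: "'a \<Rightarrow> real ^ 'd" and W :: "real ^ 'd \<Rightarrow> real"
  assumes grad: "\<And>u. GDERIV W u :> g u"
    and lip: "L-lipschitz_on UNIV g" and L: "0 < L" and nonneg: "\<And>u. 0 \<le> W u"
    and x: "x \<in> borel_measurable F" and G [measurable]: "G \<in> borel_measurable M"
    and sq: "integrable M (\<lambda>\<omega>. (norm (G \<omega>))\<^sup>2)"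
    and drift: "AE \<omega> in M. g (x \<omega>) \<bullet> vec_cond_exp M F G \<omega> \<le> b - \<beta> * W (x \<omega>)"
    and second: "AE \<omega> in M.
          real_cond_exp M F (\<lambda>\<omega>. (norm (G \<omega> - vec_cond_exp M F G \<omega>))\<^sup>2) \<omega>
            + (norm (vec_cond_exp M F G \<omega>))\<^sup>2 \<le> \<eta>0 + \<eta>1 * W (x \<omega>)"
    and \<gamma>: "0 \<le> \<gamma>"
    and prob: "measure M (space M) \<le> 1"
    and lam: "0 \<le> 1 - \<gamma> * \<beta> + \<gamma>\<^sup>2 * L * \<eta>1 / 2" (is "0 \<le> ?lam")
    and d: "0 \<le> \<gamma> * b + \<gamma>\<^sup>2 * L * \<eta>0 / 2" (is "0 \<le> ?d")
  shows "(\<integral>\<^sup>+\<omega>. ennreal (W (x \<omega> + \<gamma> *\<^sub>R G \<omega>)) \<partial>M)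
           \<le> ennreal ?lam * (\<integral>\<^sup>+\<omega>. ennreal (W (x \<omega>)) \<partial>M) + ennreal ?d"
proof -
  have W [measurable]: "W \<in> borel_measurable borel" by (rule borel_measurable_gderiv[OF grad])
  have xM [measurable]: "x \<in> borel_measurable M" by (rule measurable_from_subalg[OF subalg x])
  define A where "A N = {\<omega> \<in> space F. W (x \<omega>) \<le> real N}" for N
  have AF: "A N \<in> sets F" for N
    using x unfolding A_def by measurable
  have AM [measurable]: "A N \<in> sets M" for N
    using AF subalg by (auto simp: subalgebra_def)
  have bounded: "\<And>\<omega>. \<omega> \<in> A N \<Longrightarrow> W (x \<omega>) \<le> real N" for N by (simp add: A_def)
  note step = truncated_descent_step[where A = "A N" and N = "real N" for N,
      OF grad lip L nonneg x G sq drift second \<gamma> AF bounded]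
  have trunc: "(\<integral>\<^sup>+\<omega>. ennreal (indicator (A N) \<omega> * W (x \<omega> + \<gamma> *\<^sub>R G \<omega>)) \<partial>M)
      \<le> ennreal ?lam * (\<integral>\<^sup>+\<omega>. ennreal (W (x \<omega>)) \<partial>M) + ennreal ?d" for N
  proof -
    have "(\<integral>\<^sup>+\<omega>. ennreal (indicator (A N) \<omega> * W (x \<omega> + \<gamma> *\<^sub>R G \<omega>)) \<partial>M)
        = ennreal (\<integral>\<omega>. indicator (A N) \<omega> * W (x \<omega> + \<gamma> *\<^sub>R G \<omega>) \<partial>M)"
      by (rule nn_integral_eq_integral[OF step(2)]) (simp_all add: nonneg)
    also have "\<dots> \<le> ennreal (?lam * (\<integral>\<omega>. indicator (A N) \<omega> * W (x \<omega>) \<partial>M) + ?d)"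
    proof (rule ennreal_leI)
      have "measure M (A N) \<le> 1"
        using prob bounded_measure[of "A N"] by simp
      then have "?d * measure M (A N) \<le> ?d" using d by (rule mult_left_le)
      with step(3)[of N] show "(\<integral>\<omega>. indicator (A N) \<omega> * W (x \<omega> + \<gamma> *\<^sub>R G \<omega>) \<partial>M)
          \<le> ?lam * (\<integral>\<omega>. indicator (A N) \<omega> * W (x \<omega>) \<partial>M) + ?d"
        by linarith
    qed
    also have "\<dots> = ennreal ?lam * ennreal (\<integral>\<omega>. indicator (A N) \<omega> * W (x \<omega>) \<partial>M) + ennreal ?d"
      using lam d by (subst ennreal_plus) (auto simp: ennreal_mult nonneg)
    also have "ennreal (\<integral>\<omega>. indicator (A N) \<omega> * W (x \<omega>) \<partial>M)
        = (\<integral>\<^sup>+\<omega>. ennreal (indicator (A N) \<omega> * W (x \<omega>)) \<partial>M)"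
      by (rule nn_integral_eq_integral[OF step(1), symmetric]) (simp_all add: nonneg)
    also have "ennreal ?lam * \<dots> + ennreal ?d
        \<le> ennreal ?lam * (\<integral>\<^sup>+\<omega>. ennreal (W (x \<omega>)) \<partial>M) + ennreal ?d"
      by (intro add_right_mono mult_left_mono nn_integral_mono ennreal_leI)
        (auto simp: indicator_def nonneg)
    finally show ?thesis .
  qed
  have sup: "(SUP N. ennreal (indicator (A N) \<omega> * W (x \<omega> + \<gamma> *\<^sub>R G \<omega>)))
      = ennreal (W (x \<omega> + \<gamma> *\<^sub>R G \<omega>))" if "\<omega> \<in> space M" for \<omega>
  proof (rule antisym)
    obtain N :: nat where "W (x \<omega>) \<le> real N" using real_arch_simple by blast
    then have "\<omega> \<in> A N" using that subalg by (simp add: A_def subalgebra_def)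
    then show "ennreal (W (x \<omega> + \<gamma> *\<^sub>R G \<omega>))
        \<le> (SUP N. ennreal (indicator (A N) \<omega> * W (x \<omega> + \<gamma> *\<^sub>R G \<omega>)))"
      by (intro SUP_upper2[of N]) auto
  qed (auto intro!: SUP_least ennreal_leI simp: indicator_def nonneg)
  have "(\<integral>\<^sup>+\<omega>. ennreal (W (x \<omega> + \<gamma> *\<^sub>R G \<omega>)) \<partial>M)
      = (\<integral>\<^sup>+\<omega>. (SUP N. ennreal (indicator (A N) \<omega> * W (x \<omega> + \<gamma> *\<^sub>R G \<omega>))) \<partial>M)"
    by (intro nn_integral_cong) (simp add: sup)
  also have "\<dots> = (SUP N. \<integral>\<^sup>+\<omega>. ennreal (indicator (A N) \<omega> * W (x \<omega> + \<gamma> *\<^sub>R G \<omega>)) \<partial>M)"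
  proof (rule nn_integral_monotone_convergence_SUP)
    show "incseq (\<lambda>N \<omega>. ennreal (indicator (A N) \<omega> * W (x \<omega> + \<gamma> *\<^sub>R G \<omega>)))"
      by (auto simp: incseq_def le_fun_def indicator_def A_def nonneg intro!: ennreal_leI)
  qed measurable
  also have "\<dots> \<le> ennreal ?lam * (\<integral>\<^sup>+\<omega>. ennreal (W (x \<omega>)) \<partial>M) + ennreal ?d"
    by (rule SUP_least) (rule trunc)
  finally show ?thesis .
qed

section \<open>Adaptedness of the iterates\<close>

lemma
  assumes X: "\<And>n. n \<ge> 1 \<Longrightarrow> X n \<in> measurable M S" and w0: "w0 \<in> borel_measurable M"
  shows space_sa_filtration: "space (sa_filtration M S w0 X k) = space M"
    and subalgebra_sa_filtration: "subalgebra M (sa_filtration M S w0 X k)"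
    and measurable_sa_filtration_init: "w0 \<in> borel_measurable (sa_filtration M S w0 X k)"
    and measurable_sa_filtration_noise:
      "\<And>i. 1 \<le> i \<Longrightarrow> i \<le> k \<Longrightarrow> X i \<in> measurable (sa_filtration M S w0 X k) S"
proof -
  let ?gen = "{w0 -` A \<inter> space M | A. A \<in> sets borel} \<union>
    (\<Union>i\<in>{1..k}. {X i -` B \<inter> space M | B. B \<in> sets S})"
  have gen: "?gen \<subseteq> sets M"
    using measurable_sets[OF w0] measurable_sets[OF X] by auto
  then have Pow: "?gen \<subseteq> Pow (space M)" using sets.sets_into_space by blast
  have sets: "sets (sa_filtration M S w0 X k) = sigma_sets (space M) ?gen"
    unfolding sa_filtration_def using Pow by (rule sets_measure_of)
  show space: "space (sa_filtration M S w0 X k) = space M"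
    unfolding sa_filtration_def using Pow by (rule space_measure_of)
  show "subalgebra M (sa_filtration M S w0 X k)"
    unfolding subalgebra_def sets space using sets.sigma_sets_subset[OF gen] by simp
  show "w0 \<in> borel_measurable (sa_filtration M S w0 X k)"
    by (rule measurableI) (auto simp: sets space intro!: sigma_sets.Basic)
  show "X i \<in> measurable (sa_filtration M S w0 X k) S" if "1 \<le> i" "i \<le> k" for i
    using that measurable_space[OF X]
    by (intro measurableI) (auto simp: sets space intro!: sigma_sets.Basic)
qed

lemma measurable_sa_filtration_iterate:
  fixes H :: "'v::{real_normed_vector, second_countable_topology} \<times> 's \<Rightarrow> 'v"
  assumes X: "\<And>n. n \<ge> 1 \<Longrightarrow> X n \<in> measurable M S" and w0: "w 0 \<in> borel_measurable M"
    and H: "H \<in> borel_measurable (borel \<Otimes>\<^sub>M S)"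
    and recursion: "\<And>n \<omega>. \<omega> \<in> space M \<Longrightarrow>
          w (Suc n) \<omega> = w n \<omega> + \<gamma> (Suc n) *\<^sub>R H (w n \<omega>, X (Suc n) \<omega>)"
  shows "n \<le> k \<Longrightarrow> w n \<in> borel_measurable (sa_filtration M S (w 0) X k)"
proof (induction n)
  case 0
  show ?case by (rule measurable_sa_filtration_init[OF X w0])
next
  case (Suc n)
  let ?F = "sa_filtration M S (w 0) X k"
  have [measurable]: "w n \<in> borel_measurable ?F" using Suc by simp
  have [measurable]: "X (Suc n) \<in> measurable ?F S"
    using Suc.prems by (intro measurable_sa_filtration_noise[OF X w0]) auto
  note H [measurable]
  have "(\<lambda>\<omega>. w n \<omega> + \<gamma> (Suc n) *\<^sub>R H (w n \<omega>, X (Suc n) \<omega>)) \<in> borel_measurable ?F"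
    by measurable
  then show ?case
    by (rule measurable_cong[THEN iffD1, rotated])
      (simp add: space_sa_filtration[OF X w0] recursion)
qed

section \<open>The constants\<close>

lemma bias_alignment_le:
  assumes W: "0 \<le> W" and \<tau>: "0 \<le> \<tau>0" "0 \<le> \<tau>1" and c: "0 \<le> c"
    and g: "norm g \<le> c * sqrt W" and e: "(norm e)\<^sup>2 \<le> \<tau>0 + \<tau>1 * W"
  shows "g \<bullet> e \<le> c * sqrt \<tau>0 / 2 + c * (sqrt \<tau>0 / 2 + sqrt \<tau>1) * W"
proof -
  have e': "norm e \<le> sqrt \<tau>0 + sqrt \<tau>1 * sqrt W"
  proof -
    have "norm e \<le> sqrt (\<tau>0 + \<tau>1 * W)" using e by (rule real_le_rsqrt)
    also have "\<dots> \<le> sqrt \<tau>0 + sqrt (\<tau>1 * W)"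
      using \<tau> W by (intro sqrt_add_le_add_sqrt) auto
    finally show ?thesis by (simp add: real_sqrt_mult)
  qed
  have "g \<bullet> e \<le> norm g * norm e" by (rule norm_cauchy_schwarz)
  also have "\<dots> \<le> (c * sqrt W) * (sqrt \<tau>0 + sqrt \<tau>1 * sqrt W)"
    using g e' c W by (intro mult_mono) auto
  also have "\<dots> = c * sqrt \<tau>0 * sqrt W + c * sqrt \<tau>1 * W"
    using W by (simp add: algebra_simps)
  \<comment> \<open>The half-integer power of \<open>W\<close> is absorbed by \<open>\<surd>W \<le> (1 + W) / 2\<close>; this is where the factors
    \<open>1 / 2\<close> in \<open>b\<^sub>0\<close> and \<open>b\<^sub>1\<close> come from.\<close>
  also have "\<dots> \<le> c * sqrt \<tau>0 * ((1 + W) / 2) + c * sqrt \<tau>1 * W"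
    using arith_geo_mean_sqrt[of 1 W] W c \<tau> by (intro add_right_mono mult_left_mono) auto
  also have "\<dots> = c * sqrt \<tau>0 / 2 + c * (sqrt \<tau>0 / 2 + sqrt \<tau>1) * W"
    by (simp add: field_simps)
  finally show ?thesis .
qed

text \<open>
  Expanding \<open>(\<parallel>h\<parallel> + \<parallel>m - h\<parallel>)\<^sup>2\<close> and using \<open>\<surd>W \<le> (1 + W) / 2\<close> in the cross term produces exactly
  \<open>\<eta>\<^sub>0\<close> and \<open>\<eta>\<^sub>1\<close>.
\<close>

lemma second_moment_le:
  fixes ch \<tau> \<sigma> :: "nat \<Rightarrow> real"
  assumes W: "0 \<le> W" and const: "\<And>l. l \<in> {0, 1} \<Longrightarrow> 0 \<le> ch l \<and> 0 \<le> \<tau> l"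
    and h: "(norm h)\<^sup>2 \<le> ch 0 + ch 1 * W" and e: "(norm (m - h))\<^sup>2 \<le> \<tau> 0 + \<tau> 1 * W"
  shows "(\<sigma> 0)\<^sup>2 + (\<sigma> 1)\<^sup>2 * W + (norm m)\<^sup>2 \<le> sa_eta ch \<tau> \<sigma> 0 + sa_eta ch \<tau> \<sigma> 1 * W"
proof -
  note nn = const[of 0] const[of 1]
  have h': "norm h \<le> sqrt (ch 0) + sqrt (ch 1) * sqrt W"
    using real_le_rsqrt[OF h] sqrt_add_le_add_sqrt[of "ch 0" "ch 1 * W"] nn W
    by (simp add: real_sqrt_mult)
  have e': "norm (m - h) \<le> sqrt (\<tau> 0) + sqrt (\<tau> 1) * sqrt W"
    using real_le_rsqrt[OF e] sqrt_add_le_add_sqrt[of "\<tau> 0" "\<tau> 1 * W"] nn W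
    by (simp add: real_sqrt_mult)
  define p q r s where "p = sqrt (ch 0)" "q = sqrt (ch 1)" "r = sqrt (\<tau> 0)" "s = sqrt (\<tau> 1)"
  note pqrs = this
  have pos: "0 \<le> p" "0 \<le> q" "0 \<le> r" "0 \<le> s" using nn by (simp_all add: pqrs)
  have "norm h * norm (m - h) \<le> (p + q * sqrt W) * (r + s * sqrt W)"
    using h' e' pos W by (intro mult_mono) (auto simp: pqrs)
  also have "\<dots> = p * r + q * s * W + (p * s + q * r) * sqrt W"
    using W by (simp add: algebra_simps)
  also have "\<dots> \<le> p * r + q * s * W + (p * s + q * r) * ((1 + W) / 2)"
    using arith_geo_mean_sqrt[of 1 W] W pos by (intro add_left_mono mult_left_mono) auto
  finally have cross: "2 * (norm h * norm (m - h))
      \<le> 2 * (p * r + q * s * W) + (p * s + q * r) * (1 + W)"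
    by simp
  have "norm m \<le> norm h + norm (m - h)" using norm_triangle_ineq[of h "m - h"] by simp
  then have "(norm m)\<^sup>2 \<le> (norm h + norm (m - h))\<^sup>2" by (rule power_mono) simp
  also have "\<dots> = (norm h)\<^sup>2 + (norm (m - h))\<^sup>2 + 2 * (norm h * norm (m - h))"
    by (simp add: power2_sum)
  also have "\<dots> \<le> (ch 0 + ch 1 * W) + (\<tau> 0 + \<tau> 1 * W)
      + (2 * (p * r + q * s * W) + (p * s + q * r) * (1 + W))"
    by (intro add_mono h e cross)
  finally have "(norm m)\<^sup>2 \<le> (ch 0 + ch 1 * W) + (\<tau> 0 + \<tau> 1 * W)
      + (2 * (p * r + q * s * W) + (p * s + q * r) * (1 + W))" .
  then show ?thesis
    unfolding sa_eta_def pqrs[symmetric] by (simp add: algebra_simps)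
qed

text \<open>
  As \<open>K \<ge> \<rho>\<^sup>2 / 2 \<ge> \<beta>\<^sup>2 / 2\<close>, the factor is at least the square \<open>(1 - \<gamma> \<beta> / 2)\<^sup>2\<close>. It can be zero, for
  instance if \<open>\<beta> = \<rho>\<close>, \<open>K = \<rho>\<^sup>2 / 2\<close> and \<open>\<gamma> = 2 / \<rho>\<close>.
\<close>

lemma contraction_factor_bounds:
  fixes \<beta> \<rho> :: real
  assumes \<beta>: "0 < \<beta>" "\<beta> \<le> \<rho>" and \<rho>: "\<rho>\<^sup>2 \<le> 2 * K" and step: "\<gamma> * K \<le> \<beta>" and \<gamma>: "0 < \<gamma>"
  shows "0 \<le> 1 - \<gamma> * \<beta> + \<gamma>\<^sup>2 * K / 2"
    and "1 - \<gamma> * \<beta> + \<gamma>\<^sup>2 * K / 2 \<le> 1 - \<gamma> * \<beta> / 2"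
proof -
  have "\<beta>\<^sup>2 \<le> \<rho>\<^sup>2" using \<beta> by (intro power_mono) auto
  then have "\<beta>\<^sup>2 \<le> 2 * K" using \<rho> by linarith
  then have "\<gamma>\<^sup>2 * \<beta>\<^sup>2 \<le> \<gamma>\<^sup>2 * (2 * K)" by (intro mult_left_mono) auto
  moreover have "1 - \<gamma> * \<beta> + \<gamma>\<^sup>2 * \<beta>\<^sup>2 / 4 = (1 - \<gamma> * \<beta> / 2)\<^sup>2"
    by (simp add: power2_eq_square algebra_simps)
  moreover have "0 \<le> (1 - \<gamma> * \<beta> / 2)\<^sup>2" by simp
  ultimately show "0 \<le> 1 - \<gamma> * \<beta> + \<gamma>\<^sup>2 * K / 2" by linarith
  have "\<gamma> * (\<gamma> * K) \<le> \<gamma> * \<beta>" using step \<gamma> by simp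
  then show "1 - \<gamma> * \<beta> + \<gamma>\<^sup>2 * K / 2 \<le> 1 - \<gamma> * \<beta> / 2"
    by (simp add: power2_eq_square mult.assoc)
qed


text \<open>
  If \<open>c\<^sub>V\<close> is infinite, the smallness condition forces \<open>\<tau>\<^sub>0 = \<tau>\<^sub>1 = 0\<close>. The oracle is then unbiased, and
  by \<open>0 * \<infinity> = 0\<close> both constants are zero. So \<open>b\<^sub>0\<close> and \<open>b\<^sub>1\<close> are real in every case.
\<close>

lemma bias_constants_real:
  fixes gradW :: "'v::real_inner \<Rightarrow> 'v" and \<tau> :: "nat \<Rightarrow> real"
  assumes W: "\<And>u. 0 \<le> W u" and \<tau>: "0 \<le> \<tau> 0" "0 \<le> \<tau> 1" and cV: "0 < cV"
    and bound: "\<And>u. cV \<noteq> \<infinity> \<Longrightarrow> ereal (norm (gradW u)) \<le> cV * ereal (sqrt (W u))"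
    and less: "cV * ereal (sqrt (\<tau> 0) / 2 + sqrt (\<tau> 1)) < ereal \<rho>"
  obtains b0 b1 :: real where "sa_b0 cV \<tau> = ereal b0" "sa_b1 cV \<tau> = ereal b1"
    "0 \<le> b0" "0 \<le> b1" "b1 < \<rho>"
    "\<And>u e. (norm e)\<^sup>2 \<le> \<tau> 0 + \<tau> 1 * W u \<Longrightarrow> gradW u \<bullet> e \<le> b0 + b1 * W u"
proof (cases cV)
  case (real c)
  have c: "0 \<le> c" using cV real by simp
  have g: "norm (gradW u) \<le> c * sqrt (W u)" for u using bound[of u] real by simp
  show ?thesis
  proof
    show "sa_b0 cV \<tau> = ereal (c * sqrt (\<tau> 0) / 2)"
      by (simp add: sa_b0_def real)
    show "sa_b1 cV \<tau> = ereal (c * (sqrt (\<tau> 0) / 2 + sqrt (\<tau> 1)))"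
      by (simp add: sa_b1_def real)
    show "c * (sqrt (\<tau> 0) / 2 + sqrt (\<tau> 1)) < \<rho>" using less by (simp add: real)
    show "gradW u \<bullet> e \<le> c * sqrt (\<tau> 0) / 2 + c * (sqrt (\<tau> 0) / 2 + sqrt (\<tau> 1)) * W u"
      if "(norm e)\<^sup>2 \<le> \<tau> 0 + \<tau> 1 * W u" for u e
      using W \<tau> c g that by (rule bias_alignment_le)
  qed (use c \<tau> in auto)
next
  case PInf
  have "sqrt (\<tau> 0) / 2 + sqrt (\<tau> 1) \<le> 0"
  proof (rule ccontr)
    assume "\<not> ?thesis"
    then show False using less by (simp add: PInf)
  qed
  moreover have "0 \<le> sqrt (\<tau> 0)" "0 \<le> sqrt (\<tau> 1)" using \<tau> by auto
  ultimately have "sqrt (\<tau> 0) = 0" "sqrt (\<tau> 1) = 0" by linarith+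
  then have zero: "\<tau> 0 = 0" "\<tau> (Suc 0) = 0" by simp_all
  have "0 < \<rho>" using less by (simp add: zero flip: zero_ereal_def)
  then show ?thesis
    by (intro that[of 0 0]) (auto simp: sa_b0_def sa_b1_def zero simp flip: zero_ereal_def)
qed (use cV in simp)

lemma sa_Lambda_ereal:
  "sa_Lambda \<rho> (ereal b1) L \<eta> \<gamma> k
     = ereal (\<Prod>i=1..k. 1 - \<gamma> i * (\<rho> - b1) + (\<gamma> i)\<^sup>2 * (L * \<eta>) / 2)"
  by (induction k) (simp_all add: sa_Lambda_def sa_lambda_def mult.assoc one_ereal_def)

lemma sa_eta_bounds:
  assumes "\<And>l. l \<in> {0, 1} \<Longrightarrow> 0 \<le> ch l \<and> 0 \<le> \<tau> l" and "l \<in> {0, 1}"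
  shows "0 \<le> sa_eta ch \<tau> \<sigma> l" and "ch l \<le> sa_eta ch \<tau> \<sigma> l"
  using assms(1)[of 0] assms(1)[of 1] assms(2) by (auto simp: sa_eta_def)

section \<open>The recursion for the expectations\<close>

text \<open>
  With \<open>g = \<gamma>\<^sub>k\<^sub>+\<^sub>1\<close>, the ratio condition gives
  \<open>(1 - g \<beta> / 2) \<gamma>\<^sub>k \<le> g (1 - g \<beta> / 2) (1 + g \<beta> / 4) \<le> g - g\<^sup>2 \<beta> / 4\<close>, and multiplied by \<open>2 c / \<beta>\<close> the
  loss \<open>g\<^sup>2 \<beta> / 4\<close> pays exactly for the new term \<open>g\<^sup>2 c / 2\<close>. The constant \<open>2 b / \<beta>\<close> is the fixed point of
  \<open>z \<mapsto> (1 - g \<beta> / 2) z + g b\<close>.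
\<close>

lemma stochastic_approximation_recursion:
  fixes E :: "nat \<Rightarrow> ennreal" and \<gamma> lam :: "nat \<Rightarrow> real"
  assumes step: "\<And>n. E (Suc n) \<le> ennreal (lam (Suc n)) * E n
                      + ennreal (\<gamma> (Suc n) * b + (\<gamma> (Suc n))\<^sup>2 * c / 2)"
    and lam: "\<And>n. 0 \<le> lam n" "\<And>n. lam n \<le> 1 - \<gamma> n * \<beta> / 2"
    and \<gamma>: "\<And>n. 0 < \<gamma> n"
    and ratio: "\<And>n. \<gamma> n / \<gamma> (Suc n) \<le> 1 + \<gamma> (Suc n) * (\<beta> / 4)"
    and \<beta>: "0 < \<beta>" and b: "0 \<le> b" and c: "0 \<le> c"
  shows "E k \<le> ennreal (\<Prod>i=1..k. lam i) * E 0 + ennreal (2 * c / \<beta> * \<gamma> k + 2 * b / \<beta>)"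
proof (induction k)
  case 0
  show ?case by simp
next
  case (Suc k)
  define g where "g = \<gamma> (Suc k)"
  define P where "P = (\<Prod>i=1..k. lam i)"
  have g: "0 < g" using \<gamma> by (simp add: g_def)
  have \<gamma>k: "0 < \<gamma> k" by (rule \<gamma>)
  have P: "0 \<le> P" unfolding P_def by (intro prod_nonneg) (simp add: lam)
  have half: "0 \<le> 1 - g * \<beta> / 2" using lam[of "Suc k"] by (simp add: g_def)
  have "\<gamma> k \<le> g * (1 + g * (\<beta> / 4))"
    using ratio[of k] g by (simp add: g_def[symmetric] pos_divide_le_eq mult.commute)
  then have "(1 - g * \<beta> / 2) * \<gamma> k \<le> (1 - g * \<beta> / 2) * (g * (1 + g * (\<beta> / 4)))"
    using half by (rule mult_left_mono)
  also have "\<dots> = g - g\<^sup>2 * \<beta> / 4 - g ^ 3 * \<beta>\<^sup>2 / 8"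
    by (simp add: field_simps power2_eq_square power3_eq_cube)
  also have "\<dots> \<le> g - g\<^sup>2 * \<beta> / 4" using g by simp
  finally have key: "(1 - g * \<beta> / 2) * \<gamma> k \<le> g - g\<^sup>2 * \<beta> / 4" .
  have "lam (Suc k) * (2 * c / \<beta> * \<gamma> k + 2 * b / \<beta>)
      \<le> (1 - g * \<beta> / 2) * (2 * c / \<beta> * \<gamma> k + 2 * b / \<beta>)"
    using lam(2)[of "Suc k"] \<beta> b c \<gamma>k by (intro mult_right_mono) (auto simp: g_def)
  also have "\<dots> = 2 * c / \<beta> * ((1 - g * \<beta> / 2) * \<gamma> k) + (2 * b / \<beta> - g * b)"
    using \<beta> by (simp add: field_simps)
  also have "\<dots> \<le> 2 * c / \<beta> * (g - g\<^sup>2 * \<beta> / 4) + (2 * b / \<beta> - g * b)"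
    using key c \<beta> by (intro add_right_mono mult_left_mono) auto
  also have "\<dots> = 2 * c / \<beta> * g + 2 * b / \<beta> - (g * b + g\<^sup>2 * c / 2)"
    using \<beta> by (simp add: right_diff_distrib)
  finally have real: "lam (Suc k) * (2 * c / \<beta> * \<gamma> k + 2 * b / \<beta>) + (g * b + g\<^sup>2 * c / 2)
      \<le> 2 * c / \<beta> * g + 2 * b / \<beta>"
    by simp
  have "E (Suc k) \<le> ennreal (lam (Suc k)) * E k + ennreal (g * b + g\<^sup>2 * c / 2)"
    using step[of k] by (simp add: g_def)
  also have "\<dots> \<le> ennreal (lam (Suc k)) * (ennreal P * E 0 + ennreal (2 * c / \<beta> * \<gamma> k + 2 * b / \<beta>))
      + ennreal (g * b + g\<^sup>2 * c / 2)"
    using Suc.IH unfolding P_def by (intro add_right_mono mult_left_mono) auto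
  also have "\<dots> = ennreal (P * lam (Suc k)) * E 0
      + ennreal (lam (Suc k) * (2 * c / \<beta> * \<gamma> k + 2 * b / \<beta>) + (g * b + g\<^sup>2 * c / 2))"
  proof -
    define q where "q = 2 * c / \<beta> * \<gamma> k + 2 * b / \<beta>"
    have q: "0 \<le> q" using b c \<beta> \<gamma>k by (simp add: q_def)
    have "ennreal (lam (Suc k)) * (ennreal P * E 0 + ennreal q)
        = ennreal (P * lam (Suc k)) * E 0 + ennreal (lam (Suc k) * q)"
      using lam(1)[of "Suc k"] P q by (simp add: distrib_left ennreal_mult mult_ac)
    moreover have "ennreal (lam (Suc k) * q + (g * b + g\<^sup>2 * c / 2))
        = ennreal (lam (Suc k) * q) + ennreal (g * b + g\<^sup>2 * c / 2)"
      using lam(1)[of "Suc k"] q b c g by (intro ennreal_plus) auto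
    ultimately show ?thesis by (simp only: q_def[symmetric] add.assoc)
  qed
  also have "\<dots> \<le> ennreal (P * lam (Suc k)) * E 0 + ennreal (2 * c / \<beta> * g + 2 * b / \<beta>)"
    using real by (intro add_left_mono ennreal_leI)
  finally show ?case by (simp add: P_def g_def)
qed


section \<open>The bound for the expected objective\<close>

theorem theorem2:
  fixes M :: "'a measure"
    and S :: "'s measure"
    and h :: "real ^ 'd \<Rightarrow> real ^ 'd"
    and H :: "(real ^ 'd) \<times> 's \<Rightarrow> real ^ 'd"
    and X :: "nat \<Rightarrow> 'a \<Rightarrow> 's"
    and w :: "nat \<Rightarrow> 'a \<Rightarrow> real ^ 'd"
    and \<gamma> :: "nat \<Rightarrow> real"
    and W :: "real ^ 'd \<Rightarrow> real"
    and gradW :: "real ^ 'd \<Rightarrow> real ^ 'd"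
    and ch \<tau> \<sigma> :: "nat \<Rightarrow> real"
    and cV :: ereal
    and LV \<rho> :: real
    and k :: nat
  defines "F \<equiv> sa_filtration M S (w 0) X"
    and "HH \<equiv> (\<lambda>n \<omega>. H (w n \<omega>, X (Suc n) \<omega>))"
    and "b0 \<equiv> sa_b0 cV \<tau>"
    and "b1 \<equiv> sa_b1 cV \<tau>"
    and "eta \<equiv> sa_eta ch \<tau> \<sigma>"
  assumes prob: "prob_space M"
    and h_borel: "h \<in> borel_measurable borel"
    and H_borel: "H \<in> borel_measurable (borel \<Otimes>\<^sub>M S)"
    and X_rv: "\<And>n. n \<ge> 1 \<Longrightarrow> X n \<in> measurable M S"
    and w0_rv: "w 0 \<in> borel_measurable M"
    and recursion: "\<And>n \<omega>. \<omega> \<in> space M \<Longrightarrow>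
          w (Suc n) \<omega> = w n \<omega> + \<gamma> (Suc n) *\<^sub>R H (w n \<omega>, X (Suc n) \<omega>)"
    and W_nonneg: "\<And>u. 0 \<le> W u"
    and cV_pos: "0 < cV"
    and cV_bound: "\<And>u. cV \<noteq> \<infinity> \<Longrightarrow> ereal (norm (gradW u)) \<le> cV * ereal (sqrt (W u))"
    and A_const: "\<And>l. l \<in> {0, 1} \<Longrightarrow> 0 \<le> ch l \<and> 0 \<le> \<tau> l \<and> 0 \<le> \<sigma> l"
    and A_moment: "\<And>n. (\<integral>\<^sup>+\<omega>. ennreal ((norm (HH n \<omega>))\<^sup>2) \<partial>M) < \<infinity>"
    and A_h: "\<And>u. (norm (h u))\<^sup>2 \<le> ch 0 + ch 1 * W u"
    and A_bias: "\<And>n. AE \<omega> in M.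
          (norm (vec_cond_exp M (F n) (HH n) \<omega> - h (w n \<omega>)))\<^sup>2 \<le> \<tau> 0 + \<tau> 1 * W (w n \<omega>)"
    and A_var: "\<And>n. AE \<omega> in M.
          real_cond_exp M (F n) (\<lambda>x. (norm (HH n x - vec_cond_exp M (F n) (HH n) x))\<^sup>2) \<omega>
            \<le> (\<sigma> 0)\<^sup>2 + (\<sigma> 1)\<^sup>2 * W (w n \<omega>)"
    and B_grad: "\<And>u. GDERIV W u :> gradW u"
    and B_cont: "continuous_on UNIV gradW"
    and B_lipschitz: "LV-lipschitz_on UNIV gradW"
    and B_rho: "0 < \<rho>"
    and B_drift: "\<And>u. gradW u \<bullet> h u \<le> - \<rho> * W u"
    and C: "cV * ereal (sqrt (\<tau> 0) / 2 + sqrt (\<tau> 1)) < ereal \<rho>"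
    and D_pos: "\<And>n. 0 < \<gamma> n"
    and D_decr: "decseq \<gamma>"
    and D_max: "\<And>n. ereal (\<gamma> n) \<le> sa_gamma_max \<rho> b1 LV (eta 1) / 2"
    and D_ratio: "\<And>n. ereal (\<gamma> n / \<gamma> (Suc n)) \<le> 1 + ereal (\<gamma> (Suc n)) * ((ereal \<rho> - b1) / 4)"
  shows "nonneg_expectation M (\<lambda>\<omega>. W (w k \<omega>))
           \<le> sa_Lambda \<rho> b1 LV (eta 1) \<gamma> k * nonneg_expectation M (\<lambda>\<omega>. W (w 0 \<omega>))
             + ereal (2 * LV * eta 0) / (ereal \<rho> - b1) * ereal (\<gamma> k)
             + 2 * b0 / (ereal \<rho> - b1)"
proof -
  interpret prob_space M by (rule prob)
  have \<tau>: "0 \<le> \<tau> 0" "0 \<le> \<tau> 1" using A_const by auto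
  obtain B0 B1 where b0: "b0 = ereal B0" and b1: "b1 = ereal B1"
    and B: "0 \<le> B0" "0 \<le> B1" "B1 < \<rho>"
    and align: "\<And>u e. (norm e)\<^sup>2 \<le> \<tau> 0 + \<tau> 1 * W u \<Longrightarrow> gradW u \<bullet> e \<le> B0 + B1 * W u"
    using bias_constants_real[where W = W and gradW = gradW, OF W_nonneg \<tau> cV_pos cV_bound C]
    unfolding b0_def[symmetric] b1_def[symmetric] by metis
  define \<beta> where "\<beta> = \<rho> - B1"
  have \<beta>: "0 < \<beta>" "\<beta> \<le> \<rho>" using B by (simp_all add: \<beta>_def)
  have diff: "ereal \<rho> - b1 = ereal \<beta>" by (simp add: b1 \<beta>_def)
  have LV: "0 \<le> LV" using B_lipschitz by (rule lipschitz_on_nonneg)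
  have eta: "0 \<le> eta 0" "0 \<le> eta 1" "ch 1 \<le> eta 1"
    unfolding eta_def using A_const by (auto intro!: sa_eta_bounds)
  define lam where "lam i = 1 - \<gamma> i * \<beta> + (\<gamma> i)\<^sup>2 * (LV * eta 1) / 2" for i
  have Lambda: "sa_Lambda \<rho> b1 LV (eta 1) \<gamma> k = ereal (\<Prod>i=1..k. lam i)"
    by (simp add: b1 sa_Lambda_ereal lam_def \<beta>_def)
  define rest where "rest = 2 * (LV * eta 0) / \<beta> * \<gamma> k + 2 * B0 / \<beta>"
  have rest: "0 \<le> rest" using LV eta B \<beta> D_pos[of k] by (simp add: rest_def)
  have rest_eq: "ereal (2 * LV * eta 0) / (ereal \<rho> - b1) * ereal (\<gamma> k) + 2 * b0 / (ereal \<rho> - b1)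
      = ereal rest"
    using \<beta> by (simp add: diff b0 rest_def mult.assoc)
  define E where "E n = (\<integral>\<^sup>+\<omega>. ennreal (W (w n \<omega>)) \<partial>M)" for n
  show ?thesis
  proof (cases "\<forall>u. W u = 0")
    case True
    then have "nonneg_expectation M (\<lambda>\<omega>. W (w n \<omega>)) = 0" for n
      by (simp add: nonneg_expectation_def zero_ennreal.rep_eq)
    then show ?thesis using rest unfolding add.assoc rest_eq by simp
  next
    case False
    then obtain u0 where u0: "W u0 \<noteq> 0" by blast
    \<comment> \<open>The Lipschitz constant is enlarged to be positive, as required for gradient
      steps of size \<open>1 / L\<close>; letting \<open>\<epsilon>\<close> tend to zero then also excludes \<open>LV = 0\<close>.\<close>
    have rate_eps: "\<rho>\<^sup>2 \<le> 2 * (LV + \<epsilon>) * ch 1" if "0 < \<epsilon>" for \<epsilon>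
    proof (rule drift_rate_le[OF B_grad _ _ W_nonneg B_drift B_rho A_h _ _ u0])
      show "(LV + \<epsilon>)-lipschitz_on UNIV gradW"
        using that by (intro lipschitz_on_le[OF B_lipschitz]) simp
    qed (use LV that A_const in auto)
    have rate: "\<rho>\<^sup>2 \<le> 2 * LV * ch 1"
    proof (rule field_le_epsilon)
      fix e :: real assume e: "0 < e"
      define c where "c = ch 1 + 1"
      have c: "0 < c" "ch 1 \<le> c" using A_const[of 1] by (simp_all add: c_def)
      define \<epsilon> where "\<epsilon> = e / (2 * c)"
      have \<epsilon>: "0 < \<epsilon>" using e c by (simp add: \<epsilon>_def)
      have "2 * \<epsilon> * ch 1 \<le> 2 * \<epsilon> * c" using \<epsilon> c by simp
      also have "\<dots> = e" using c by (simp add: \<epsilon>_def)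
      finally show "\<rho>\<^sup>2 \<le> 2 * LV * ch 1 + e"
        using rate_eps[OF \<epsilon>] by (simp add: algebra_simps)
    qed
    have "LV * ch 1 \<le> LV * eta 1" using eta LV by (intro mult_left_mono)
    with rate have K: "\<rho>\<^sup>2 \<le> 2 * (LV * eta 1)" by linarith
    have K_pos: "0 < LV * eta 1" using K B_rho by (smt (verit) zero_less_power)
    have L: "0 < LV" using K_pos LV by (cases "LV = 0") auto
    have step: "\<gamma> n * (LV * eta 1) \<le> \<beta>" for n
    proof -
      have "sa_gamma_max \<rho> b1 LV (eta 1) / 2 = ereal (\<beta> / (LV * eta 1))"
        using K_pos by (auto simp: sa_gamma_max_def diff)
      then show ?thesis using D_max[of n] K_pos by (simp add: pos_le_divide_eq)
    qed
    have lam: "0 \<le> lam n" "lam n \<le> 1 - \<gamma> n * \<beta> / 2" for n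
      unfolding lam_def by (rule contraction_factor_bounds[OF \<beta> K step D_pos])+
    have ratio: "\<gamma> n / \<gamma> (Suc n) \<le> 1 + \<gamma> (Suc n) * (\<beta> / 4)" for n
      using D_ratio[of n] by (simp add: diff one_ereal_def)
    have one_step: "E (Suc n) \<le> ennreal (lam (Suc n)) * E n
        + ennreal (\<gamma> (Suc n) * B0 + (\<gamma> (Suc n))\<^sup>2 * (LV * eta 0) / 2)" for n
    proof -
      interpret finite_measure_subalgebra M "F n"
        by unfold_locales (simp add: F_def subalgebra_sa_filtration[OF X_rv w0_rv])
      have wF: "w n \<in> borel_measurable (F n)"
        unfolding F_def
        by (rule measurable_sa_filtration_iterate[OF X_rv w0_rv H_borel recursion order_refl])
      have [measurable]: "w n \<in> borel_measurable M" "X (Suc n) \<in> measurable M S"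
        using measurable_from_subalg[OF subalg wF] X_rv by auto
      note H_borel [measurable]
      have HH_meas [measurable]: "HH n \<in> borel_measurable M" unfolding HH_def by measurable
      have sq: "integrable M (\<lambda>\<omega>. (norm (HH n \<omega>))\<^sup>2)"
        using A_moment[of n] by (intro integrableI_bounded) (auto simp: top.not_eq_extremum)
      let ?m = "vec_cond_exp M (F n) (HH n)"
      have drift: "AE \<omega> in M. gradW (w n \<omega>) \<bullet> ?m \<omega> \<le> B0 - \<beta> * W (w n \<omega>)"
        using A_bias[of n]
      proof eventually_elim
        case (elim \<omega>)
        have "gradW (w n \<omega>) \<bullet> ?m \<omega>
            = gradW (w n \<omega>) \<bullet> h (w n \<omega>) + gradW (w n \<omega>) \<bullet> (?m \<omega> - h (w n \<omega>))"
          by (simp add: inner_diff_right)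
        also have "\<dots> \<le> - \<rho> * W (w n \<omega>) + (B0 + B1 * W (w n \<omega>))"
          by (intro add_mono B_drift align elim)
        finally show ?case by (simp add: \<beta>_def algebra_simps)
      qed
      have second: "AE \<omega> in M.
          real_cond_exp M (F n) (\<lambda>\<omega>. (norm (HH n \<omega> - ?m \<omega>))\<^sup>2) \<omega> + (norm (?m \<omega>))\<^sup>2
            \<le> eta 0 + eta 1 * W (w n \<omega>)"
        using A_bias[of n] A_var[of n]
      proof eventually_elim
        case (elim \<omega>)
        have "(\<sigma> 0)\<^sup>2 + (\<sigma> 1)\<^sup>2 * W (w n \<omega>) + (norm (?m \<omega>))\<^sup>2 \<le> eta 0 + eta 1 * W (w n \<omega>)"
          unfolding eta_def
          by (rule second_moment_le[OF W_nonneg _ A_h elim(1)]) (use A_const in blast)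
        with elim(2) show ?case by linarith
      qed
      have "E (Suc n) = (\<integral>\<^sup>+\<omega>. ennreal (W (w n \<omega> + \<gamma> (Suc n) *\<^sub>R HH n \<omega>)) \<partial>M)"
        unfolding E_def by (intro nn_integral_cong) (simp add: recursion HH_def)
      also have "\<dots> \<le> ennreal (1 - \<gamma> (Suc n) * \<beta> + (\<gamma> (Suc n))\<^sup>2 * LV * eta 1 / 2) * E n
          + ennreal (\<gamma> (Suc n) * B0 + (\<gamma> (Suc n))\<^sup>2 * LV * eta 0 / 2)"
        unfolding E_def
        by (rule expected_descent_step[OF B_grad B_lipschitz L W_nonneg wF HH_meas sq drift second])
          (use D_pos[of "Suc n"] lam(1)[of "Suc n"] B LV eta prob_space
            in \<open>auto simp: lam_def mult.assoc\<close>)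
      finally show ?thesis by (simp add: lam_def mult.assoc)
    qed
    have "E k \<le> ennreal (\<Prod>i=1..k. lam i) * E 0 + ennreal rest"
      unfolding rest_def
      by (rule stochastic_approximation_recursion[where E = E and lam = lam and \<gamma> = \<gamma>])
        (use one_step lam D_pos ratio \<beta> B LV eta in auto)
    then have "enn2ereal (E k) \<le> enn2ereal (ennreal (\<Prod>i=1..k. lam i) * E 0 + ennreal rest)"
      by (simp add: less_eq_ennreal.rep_eq)
    also have "\<dots> = ereal (\<Prod>i=1..k. lam i) * enn2ereal (E 0) + ereal rest"
      using rest lam by (simp add: plus_ennreal.rep_eq times_ennreal.rep_eq enn2ereal_ennreal prod_nonneg)
    finally show ?thesis
      unfolding nonneg_expectation_def E_def[symmetric] Lambda add.assoc rest_eq .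
  qed
qed

end
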